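(* Consider the two-dimensional velocity-driven annulus design problem described in the context, with $0<r_i<r_o$, $\mu>0$, $k_H\ge k_L>0$ and $0\le\gamma\le 1$. For a single-interface layout with inner permeability $k_1$, outer permeability $k_2$ and interface radius $\xi$, the velocity is $v_r(r)=v_o\, r_i/r$ and the total rate of dissipation is $$\Phi(\xi) = 2\pi\mu v_o^2 r_i^2\,\Upsilon_{\mathrm{2D}}(\xi), \qquad \Upsilon_{\mathrm{2D}}(\xi) := \frac{1}{k_1}\ln\left(\frac{\xi}{r_i}\right) + \frac{1}{k_2}\ln\left(\frac{r_o}{\xi}\right).$$ Moreover, among all admissible single-interface layouts, the total rate of dissipation is minimized by placing the high-permeability material near the inner boundary (that is, $k_1=k_H$, $k_2=k_L$) with the material interface located at $$\widehat{\xi}_{\mathrm{2D}} = \sqrt{(1-\gamma) r_i^2 + \gamma r_o^2}.$$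
   Context: The domain is the annulus $r_i<r<r_o$ in the plane. Two porous materials with permeabilities $k_H$ (high) and $k_L$ (low) fill the annulus. A single-interface layout is a radially symmetric permeability field $$k(r)=k_1 \ \text{ for } r_i<r<\xi,\qquad k(r)=k_2\ \text{ for } \xi<r<r_o,$$ where $\xi\in[r_i,r_o]$ and either $(k_1,k_2)=(k_H,k_L)$ or $(k_1,k_2)=(k_L,k_H)$. The layout is admissible if the area occupied by the high-permeability material is at most $\gamma$ times the area of the annulus: this means $\xi^2-r_i^2\le\gamma(r_o^2-r_i^2)$ when $(k_1,k_2)=(k_H,k_L)$, and $r_o^2-\xi^2\le\gamma(r_o^2-r_i^2)$ when $(k_1,k_2)=(k_L,k_H)$. For a given layout, the radial velocity $v_r(r)$ and pressure $p(r)$ solve the Darcy equations $$\frac{\mu}{k(r)}v_r+\frac{dp}{dr}=0,\qquad \frac{1}{r}\frac{d(r v_r)}{dr}=0 \quad\text{in }(r_i,r_o)$$ (away from the interface), with boundary conditions $v_r(r_i)=v_o$ (a prescribed real constant) and $p(r_o)=p_o$, and with $p$ and $v_r$ continuous at $r=\xi$. The total rate of dissipation is $$\Phi=\int_{r_i}^{r_o}\frac{\mu}{k(r)}\,v_r(r)^2\,(2\pi r)\,dr.$$ *)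

theory Defs
  imports "HOL-Analysis.Analysis"
begin

text \<open>
  The value at the interface \<open>r = \<xi>\<close> is immaterial: the Darcy equations are only imposed away
  from the interface, and a single point does not affect the dissipation integral.
\<close>

definition permeability :: "real \<Rightarrow> real \<Rightarrow> real \<Rightarrow> real \<Rightarrow> real" where
  "permeability k1 k2 \<xi> r = (if r < \<xi> then k1 else k2)"

definition single_interface_layout ::
  "real \<Rightarrow> real \<Rightarrow> real \<Rightarrow> real \<Rightarrow> real \<Rightarrow> real \<Rightarrow> real \<Rightarrow> bool" where
  "single_interface_layout r\<^sub>i r\<^sub>o kH kL k1 k2 \<xi> \<longleftrightarrow>
     r\<^sub>i \<le> \<xi> \<and> \<xi> \<le> r\<^sub>o \<and> ((k1, k2) = (kH, kL) \<or> (k1, k2) = (kL, kH))"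

text \<open>
  The common factor \<open>pi\<close> of the areas is cancelled. In the degenerate case \<open>kH = kL\<close>, where the
  pair \<open>(k1, k2)\<close> does not tell which material is inside, either area bound suffices.
\<close>

definition admissible_layout ::
  "real \<Rightarrow> real \<Rightarrow> real \<Rightarrow> real \<Rightarrow> real \<Rightarrow> real \<Rightarrow> real \<Rightarrow> real \<Rightarrow> bool" where
  "admissible_layout r\<^sub>i r\<^sub>o kH kL \<gamma> k1 k2 \<xi> \<longleftrightarrow>
     r\<^sub>i \<le> \<xi> \<and> \<xi> \<le> r\<^sub>o \<and>
     ((k1, k2) = (kH, kL) \<and> \<xi>\<^sup>2 - r\<^sub>i\<^sup>2 \<le> \<gamma> * (r\<^sub>o\<^sup>2 - r\<^sub>i\<^sup>2) \<or>
      (k1, k2) = (kL, kH) \<and> r\<^sub>o\<^sup>2 - \<xi>\<^sup>2 \<le> \<gamma> * (r\<^sub>o\<^sup>2 - r\<^sub>i\<^sup>2))"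

text \<open>
  Continuity is required on the closed interval: this covers continuity at the interface (wherever
  it lies in \<open>[r\<^sub>i, r\<^sub>o]\<close>) and ties the boundary values to the values inside.
\<close>

definition darcy_solution ::
  "real \<Rightarrow> real \<Rightarrow> real \<Rightarrow> real \<Rightarrow> real \<Rightarrow> (real \<Rightarrow> real) \<Rightarrow> real \<Rightarrow>
    (real \<Rightarrow> real) \<Rightarrow> (real \<Rightarrow> real) \<Rightarrow> bool" where
  "darcy_solution r\<^sub>i r\<^sub>o \<mu> v\<^sub>o p\<^sub>o k \<xi> v p \<longleftrightarrow>
     continuous_on {r\<^sub>i..r\<^sub>o} v \<and> continuous_on {r\<^sub>i..r\<^sub>o} p \<and>
     (\<forall>r\<in>{r\<^sub>i<..<r\<^sub>o} - {\<xi>}.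
        p differentiable (at r) \<and>
        (\<lambda>s. s * v s) differentiable (at r) \<and>
        \<mu> / k r * v r + deriv p r = 0 \<and>
        1 / r * deriv (\<lambda>s. s * v s) r = 0) \<and>
     v r\<^sub>i = v\<^sub>o \<and> p r\<^sub>o = p\<^sub>o"

definition dissipation ::
  "real \<Rightarrow> real \<Rightarrow> real \<Rightarrow> (real \<Rightarrow> real) \<Rightarrow> (real \<Rightarrow> real) \<Rightarrow> real" where
  "dissipation r\<^sub>i r\<^sub>o \<mu> k v = integral {r\<^sub>i..r\<^sub>o} (\<lambda>r. \<mu> / k r * (v r)\<^sup>2 * (2 * pi * r))"

definition Upsilon2D :: "real \<Rightarrow> real \<Rightarrow> real \<Rightarrow> real \<Rightarrow> real \<Rightarrow> real" where
  "Upsilon2D r\<^sub>i r\<^sub>o k1 k2 \<xi> = 1 / k1 * ln (\<xi> / r\<^sub>i) + 1 / k2 * ln (r\<^sub>o / \<xi>)"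

definition xi_hat2D :: "real \<Rightarrow> real \<Rightarrow> real \<Rightarrow> real" where
  "xi_hat2D r\<^sub>i r\<^sub>o \<gamma> = sqrt ((1 - \<gamma>) * r\<^sub>i\<^sup>2 + \<gamma> * r\<^sub>o\<^sup>2)"

end

theory Submission
  imports Defs
begin

text \<open>
  The continuity equation says that \<open>r * v r\<close> is constant on each side of the interface, and
  continuity of \<open>v\<close> makes it one constant, \<open>v\<^sub>o * r\<^sub>i\<close> (\<open>darcy_velocity\<close>). So the velocity does
  not depend on the layout, and both the pressure and the dissipation come from the same function:
  a primitive \<open>resistance\<close> of \<open>1 / (k r * r)\<close>. Integrating it gives \<open>p\<close> from Darcy's law, and its
  increment over \<open>{r\<^sub>i..r\<^sub>o}\<close> is \<open>Upsilon2D\<close> (\<open>darcy_dissipation\<close>).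

  As \<open>ln (\<xi> / r\<^sub>i)\<close> and \<open>ln (r\<^sub>o / \<xi>)\<close> add up to \<open>ln (r\<^sub>o / r\<^sub>i)\<close>, in both arrangements \<open>Upsilon2D\<close>
  is \<open>ln (r\<^sub>o / r\<^sub>i) / kL\<close> minus the gain \<open>1 / kL - 1 / kH\<close> times the logarithm of the ratio of the
  radii bounding the high-permeability ring. The optimal layout therefore maximizes this
  ratio under a bound on the area of the ring. If the ring is inside, the ratio is \<open>\<xi> / r\<^sub>i\<close> and the area bound is exactly
  \<open>\<xi> \<le> xi_hat2D r\<^sub>i r\<^sub>o \<gamma>\<close>. If it is outside, the ratio is \<open>r\<^sub>o / \<xi>\<close>, and moving the same area to
  the inner boundary increases the ratio (\<open>inner_ring_ratio\<close>).
\<close>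

section \<open>A primitive of the radial resistance\<close>

text \<open>
  The two logarithms are glued with \<open>min\<close> and \<open>max\<close>, so that continuity at the interface is
  immediate; on either side one of the summands is constant.
\<close>

definition resistance :: "real \<Rightarrow> real \<Rightarrow> real \<Rightarrow> real \<Rightarrow> real" where
  "resistance k1 k2 \<xi> r = ln (min r \<xi>) / k1 + ln (max r \<xi>) / k2"

lemma continuous_on_resistance:
  assumes "\<And>r. r \<in> S \<Longrightarrow> 0 < r" "0 < \<xi>"
  shows "continuous_on S (resistance k1 k2 \<xi>)"
  unfolding resistance_def divide_inverse
  using assms by (intro continuous_intros) (auto simp: min_def max_def dest: order_less_imp_not_eq2)

lemma DERIV_resistance:
  assumes "0 < r" "r \<noteq> \<xi>"
  shows "(resistance k1 k2 \<xi> has_real_derivative 1 / (permeability k1 k2 \<xi> r * r)) (at r)"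
proof (cases "r < \<xi>")
  case True
  have "((\<lambda>s. ln s / k1 + ln \<xi> / k2) has_real_derivative 1 / (permeability k1 k2 \<xi> r * r)) (at r)"
    using assms True
    unfolding divide_inverse
    by (auto intro!: derivative_eq_intros simp: permeability_def divide_inverse)
  then show ?thesis
    by (rule has_field_derivative_transform_within_open[of _ _ _ "{..<\<xi>}"])
       (use True in \<open>auto simp: resistance_def min_def max_def\<close>)
next
  case False
  have "((\<lambda>s. ln \<xi> / k1 + ln s / k2) has_real_derivative 1 / (permeability k1 k2 \<xi> r * r)) (at r)"
    using assms False
    unfolding divide_inverse
    by (auto intro!: derivative_eq_intros simp: permeability_def divide_inverse)
  then show ?thesis
    by (rule has_field_derivative_transform_within_open[of _ _ _ "{\<xi><..}"])
       (use False assms in \<open>auto simp: resistance_def min_def max_def\<close>)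
qed

lemma resistance_increment:
  assumes "0 < r\<^sub>i" "r\<^sub>i \<le> \<xi>" "\<xi> \<le> r\<^sub>o"
  shows "resistance k1 k2 \<xi> r\<^sub>o - resistance k1 k2 \<xi> r\<^sub>i = Upsilon2D r\<^sub>i r\<^sub>o k1 k2 \<xi>"
  using assms by (simp add: resistance_def Upsilon2D_def ln_div diff_divide_distrib)

section \<open>The Darcy flow in the annulus\<close>

lemma darcy_velocity:
  assumes "0 < r\<^sub>i" "darcy_solution r\<^sub>i r\<^sub>o \<mu> v\<^sub>o p\<^sub>o k \<xi> v p" "r \<in> {r\<^sub>i..r\<^sub>o}"
  shows "v r = v\<^sub>o * r\<^sub>i / r"
proof -
  have flux_deriv: "((\<lambda>s. s * v s) has_derivative (\<lambda>h. 0)) (at x within {r\<^sub>i..r\<^sub>o})"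
    if x: "x \<in> {r\<^sub>i..r\<^sub>o} - {r\<^sub>i, r\<^sub>o, \<xi>}" for x
  proof -
    have "(\<lambda>s. s * v s) differentiable (at x)" "deriv (\<lambda>s. s * v s) x = 0"
      using assms(1,2) x by (auto simp: darcy_solution_def)
    then have "((\<lambda>s. s * v s) has_real_derivative 0) (at x)"
      by (metis DERIV_deriv_iff_real_differentiable)
    then have "((\<lambda>s. s * v s) has_derivative (\<lambda>h. 0)) (at x)"
      by (simp add: has_field_derivative_def lambda_zero)
    then show ?thesis
      by (rule has_derivative_at_withinI)
  qed
  have "continuous_on {r\<^sub>i..r\<^sub>o} (\<lambda>s. s * v s)"
    using assms(2) by (auto simp: darcy_solution_def intro!: continuous_intros)
  then have "r * v r = r\<^sub>i * v\<^sub>o"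
    by (rule has_derivative_zero_unique_strong_interval[of "{r\<^sub>i, r\<^sub>o, \<xi>}", rotated])
       (use flux_deriv assms in \<open>auto simp: darcy_solution_def\<close>)
  then show ?thesis
    using assms(1,3) by (simp add: field_simps)
qed

lemma darcy_solution_exists:
  assumes "0 < r\<^sub>i" "r\<^sub>i \<le> \<xi>"
  shows "darcy_solution r\<^sub>i r\<^sub>o \<mu> v\<^sub>o p\<^sub>o (permeability k1 k2 \<xi>) \<xi> (\<lambda>r. v\<^sub>o * r\<^sub>i / r)
    (\<lambda>r. p\<^sub>o + \<mu> * v\<^sub>o * r\<^sub>i * (resistance k1 k2 \<xi> r\<^sub>o - resistance k1 k2 \<xi> r))"
    (is "darcy_solution _ _ _ _ _ ?k _ ?v ?p")
proof -
  have "continuous_on {r\<^sub>i..r\<^sub>o} ?v"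
    using assms by (intro continuous_intros) auto
  moreover have "continuous_on {r\<^sub>i..r\<^sub>o} ?p"
    using assms by (intro continuous_intros continuous_on_resistance) auto
  moreover have "?p differentiable (at r)" "\<mu> / ?k r * ?v r + deriv ?p r = 0"
    if "r \<in> {r\<^sub>i<..<r\<^sub>o} - {\<xi>}" for r
  proof -
    have "(?p has_real_derivative - (\<mu> * v\<^sub>o * r\<^sub>i * (1 / (?k r * r)))) (at r)"
      using that assms by (auto intro!: derivative_eq_intros DERIV_resistance)
    then show "?p differentiable (at r)" "\<mu> / ?k r * ?v r + deriv ?p r = 0"
      by (auto simp: real_differentiable_def DERIV_imp_deriv)
  qed
  moreover have "(\<lambda>s. s * ?v s) differentiable (at r)" "deriv (\<lambda>s. s * ?v s) r = 0"
    if "r \<in> {r\<^sub>i<..<r\<^sub>o} - {\<xi>}" for r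
  proof -
    \<comment> \<open>The flux is \<open>v\<^sub>o * r\<^sub>i\<close> on \<open>{0<..}\<close> only: at the origin \<open>x / 0 = 0\<close> makes it vanish.\<close>
    have "((\<lambda>s. s * ?v s) has_real_derivative 0) (at r)"
      by (rule has_field_derivative_transform_within_open[of "\<lambda>s. v\<^sub>o * r\<^sub>i" _ _ "{0<..}"])
         (use that assms in auto)
    then show "(\<lambda>s. s * ?v s) differentiable (at r)" "deriv (\<lambda>s. s * ?v s) r = 0"
      by (auto simp: real_differentiable_def DERIV_imp_deriv)
  qed
  ultimately show ?thesis
    using assms(1) by (simp add: darcy_solution_def)
qed

lemma darcy_dissipation:
  assumes "0 < r\<^sub>i" "r\<^sub>i \<le> \<xi>" "\<xi> \<le> r\<^sub>o"
    and "darcy_solution r\<^sub>i r\<^sub>o \<mu> v\<^sub>o p\<^sub>o (permeability k1 k2 \<xi>) \<xi> v p"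
  shows "dissipation r\<^sub>i r\<^sub>o \<mu> (permeability k1 k2 \<xi>) v =
    2 * pi * \<mu> * v\<^sub>o\<^sup>2 * r\<^sub>i\<^sup>2 * Upsilon2D r\<^sub>i r\<^sub>o k1 k2 \<xi>"
proof -
  let ?k = "permeability k1 k2 \<xi>" and ?R = "resistance k1 k2 \<xi>"
  have "((\<lambda>r. 1 / (?k r * r)) has_integral ?R r\<^sub>o - ?R r\<^sub>i) {r\<^sub>i..r\<^sub>o}"
  proof (rule fundamental_theorem_of_calculus_interior_strong[of "{\<xi>}"])
    show "(?R has_vector_derivative 1 / (?k r * r)) (at r)" if "r \<in> {r\<^sub>i<..<r\<^sub>o} - {\<xi>}" for r
      using that assms(1) DERIV_resistance[of r \<xi>]
      by (simp add: has_real_derivative_iff_has_vector_derivative)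
    show "continuous_on {r\<^sub>i..r\<^sub>o} ?R"
      using assms(1,2) by (intro continuous_on_resistance) auto
  qed (use assms in auto)
  then have "((\<lambda>r. 2 * pi * \<mu> * v\<^sub>o\<^sup>2 * r\<^sub>i\<^sup>2 * (1 / (?k r * r))) has_integral
      2 * pi * \<mu> * v\<^sub>o\<^sup>2 * r\<^sub>i\<^sup>2 * Upsilon2D r\<^sub>i r\<^sub>o k1 k2 \<xi>) {r\<^sub>i..r\<^sub>o}"
    unfolding resistance_increment[OF assms(1-3)] by (rule has_integral_mult_right)
  then have "((\<lambda>r. \<mu> / ?k r * (v r)\<^sup>2 * (2 * pi * r)) has_integral
      2 * pi * \<mu> * v\<^sub>o\<^sup>2 * r\<^sub>i\<^sup>2 * Upsilon2D r\<^sub>i r\<^sub>o k1 k2 \<xi>) {r\<^sub>i..r\<^sub>o}"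
  proof (rule has_integral_eq[rotated])
    fix r assume r: "r \<in> {r\<^sub>i..r\<^sub>o}"
    then have "v r = v\<^sub>o * r\<^sub>i / r" "r \<noteq> 0"
      using darcy_velocity[OF assms(1,4) r] assms(1) by auto
    then show "2 * pi * \<mu> * v\<^sub>o\<^sup>2 * r\<^sub>i\<^sup>2 * (1 / (?k r * r)) = \<mu> / ?k r * (v r)\<^sup>2 * (2 * pi * r)"
      by (simp add: power2_eq_square)
  qed
  then show ?thesis
    unfolding dissipation_def by (rule integral_unique)
qed

section \<open>The optimal layout\<close>

lemma xi_hat2D_square:
  assumes "0 \<le> \<gamma>" "\<gamma> \<le> 1"
  shows "(xi_hat2D r\<^sub>i r\<^sub>o \<gamma>)\<^sup>2 = r\<^sub>i\<^sup>2 + \<gamma> * (r\<^sub>o\<^sup>2 - r\<^sub>i\<^sup>2)"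
proof -
  have "0 \<le> (1 - \<gamma>) * r\<^sub>i\<^sup>2 + \<gamma> * r\<^sub>o\<^sup>2"
    using assms by simp
  then have "(xi_hat2D r\<^sub>i r\<^sub>o \<gamma>)\<^sup>2 = (1 - \<gamma>) * r\<^sub>i\<^sup>2 + \<gamma> * r\<^sub>o\<^sup>2"
    unfolding xi_hat2D_def by (rule real_sqrt_pow2)
  then show ?thesis
    by (simp add: algebra_simps)
qed

lemma xi_hat2D_bounds:
  assumes "0 < r\<^sub>i" "r\<^sub>i \<le> r\<^sub>o" "0 \<le> \<gamma>" "\<gamma> \<le> 1"
  shows "r\<^sub>i \<le> xi_hat2D r\<^sub>i r\<^sub>o \<gamma>" "xi_hat2D r\<^sub>i r\<^sub>o \<gamma> \<le> r\<^sub>o"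
proof -
  have sq: "(xi_hat2D r\<^sub>i r\<^sub>o \<gamma>)\<^sup>2 = r\<^sub>i\<^sup>2 + \<gamma> * (r\<^sub>o\<^sup>2 - r\<^sub>i\<^sup>2)"
    using assms(3,4) by (rule xi_hat2D_square)
  have "r\<^sub>i\<^sup>2 \<le> r\<^sub>o\<^sup>2"
    using assms(1,2) by (intro power_mono) auto
  then have "0 \<le> \<gamma> * (r\<^sub>o\<^sup>2 - r\<^sub>i\<^sup>2)" "\<gamma> * (r\<^sub>o\<^sup>2 - r\<^sub>i\<^sup>2) \<le> 1 * (r\<^sub>o\<^sup>2 - r\<^sub>i\<^sup>2)"
    using assms(3,4) by (simp, intro mult_right_mono) auto
  then have "r\<^sub>i\<^sup>2 \<le> (xi_hat2D r\<^sub>i r\<^sub>o \<gamma>)\<^sup>2" "(xi_hat2D r\<^sub>i r\<^sub>o \<gamma>)\<^sup>2 \<le> r\<^sub>o\<^sup>2"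
    unfolding sq by auto
  moreover have "0 \<le> xi_hat2D r\<^sub>i r\<^sub>o \<gamma>"
    using assms by (simp add: xi_hat2D_def)
  ultimately show "r\<^sub>i \<le> xi_hat2D r\<^sub>i r\<^sub>o \<gamma>" "xi_hat2D r\<^sub>i r\<^sub>o \<gamma> \<le> r\<^sub>o"
    using assms(1,2) by (auto intro: power2_le_imp_le)
qed

text \<open>
  A ring of given area has the larger ratio of radii the closer it is to the center. The claim
  amounts to \<open>r\<^sub>o\<^sup>2 * r\<^sub>i\<^sup>2 \<le> \<eta>\<^sup>2 * \<xi>\<^sup>2\<close>: the factors on the right have at least the same sum
  \<open>r\<^sub>i\<^sup>2 + r\<^sub>o\<^sup>2\<close>, and for this sum the product, concave in \<open>\<xi>\<^sup>2\<close>, is smallest when \<open>\<xi>\<^sup>2\<close> is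
  one of the endpoints \<open>r\<^sub>i\<^sup>2\<close> and \<open>r\<^sub>o\<^sup>2\<close>.
\<close>

lemma inner_ring_ratio:
  fixes r\<^sub>i r\<^sub>o \<xi> \<eta> :: real
  assumes "0 < r\<^sub>i" "r\<^sub>i \<le> \<xi>" "\<xi> \<le> r\<^sub>o" "0 \<le> \<eta>" "r\<^sub>o\<^sup>2 - \<xi>\<^sup>2 \<le> \<eta>\<^sup>2 - r\<^sub>i\<^sup>2"
  shows "r\<^sub>o / \<xi> \<le> \<eta> / r\<^sub>i"
proof -
  have "r\<^sub>i\<^sup>2 \<le> \<xi>\<^sup>2" "\<xi>\<^sup>2 \<le> r\<^sub>o\<^sup>2"
    using assms(1-3) by (auto intro!: power_mono)
  then have "0 \<le> (\<xi>\<^sup>2 - r\<^sub>i\<^sup>2) * (r\<^sub>o\<^sup>2 - \<xi>\<^sup>2)"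
    by simp
  then have "r\<^sub>o\<^sup>2 * r\<^sub>i\<^sup>2 \<le> (r\<^sub>i\<^sup>2 + r\<^sub>o\<^sup>2 - \<xi>\<^sup>2) * \<xi>\<^sup>2"
    by (simp add: algebra_simps)
  also have "\<dots> \<le> \<eta>\<^sup>2 * \<xi>\<^sup>2"
    using assms(5) by (intro mult_right_mono) auto
  finally have "(r\<^sub>o * r\<^sub>i)\<^sup>2 \<le> (\<eta> * \<xi>)\<^sup>2"
    by (simp add: power_mult_distrib)
  then have "r\<^sub>o * r\<^sub>i \<le> \<eta> * \<xi>"
    by (rule power2_le_imp_le) (use assms in auto)
  then show ?thesis
    using assms(1,2) by (simp add: field_simps)
qed

lemma Upsilon2D_xi_hat2D_le:
  assumes "0 < r\<^sub>i" "r\<^sub>i < r\<^sub>o" "0 < kL" "kL \<le> kH" "0 \<le> \<gamma>" "\<gamma> \<le> 1"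
    and "admissible_layout r\<^sub>i r\<^sub>o kH kL \<gamma> k1 k2 \<xi>"
  shows "Upsilon2D r\<^sub>i r\<^sub>o kH kL (xi_hat2D r\<^sub>i r\<^sub>o \<gamma>) \<le> Upsilon2D r\<^sub>i r\<^sub>o k1 k2 \<xi>"
proof -
  define \<eta> where "\<eta> = xi_hat2D r\<^sub>i r\<^sub>o \<gamma>"
  have \<eta>: "r\<^sub>i \<le> \<eta>" "\<eta> \<le> r\<^sub>o" "\<eta>\<^sup>2 - r\<^sub>i\<^sup>2 = \<gamma> * (r\<^sub>o\<^sup>2 - r\<^sub>i\<^sup>2)"
    using xi_hat2D_bounds[of r\<^sub>i r\<^sub>o \<gamma>] xi_hat2D_square[of \<gamma> r\<^sub>i r\<^sub>o] assms(1-6)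
    by (auto simp: \<eta>_def)
  have \<xi>: "r\<^sub>i \<le> \<xi>" "\<xi> \<le> r\<^sub>o"
    using assms(7) by (auto simp: admissible_layout_def)
  have gain: "0 \<le> 1 / kL - 1 / kH"
    using assms(3,4) by (simp add: frac_le)
  have inner: "Upsilon2D r\<^sub>i r\<^sub>o kH kL x = ln (r\<^sub>o / r\<^sub>i) / kL - (1 / kL - 1 / kH) * ln (x / r\<^sub>i)"
    if "0 < x" for x
    using assms(1,2) that by (simp add: Upsilon2D_def ln_div algebra_simps diff_divide_distrib)
  have outer: "Upsilon2D r\<^sub>i r\<^sub>o kL kH x = ln (r\<^sub>o / r\<^sub>i) / kL - (1 / kL - 1 / kH) * ln (r\<^sub>o / x)"
    if "0 < x" for x
    using assms(1,2) that by (simp add: Upsilon2D_def ln_div algebra_simps diff_divide_distrib)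
  \<comment> \<open>Here \<open>y\<close> is the logarithm of the ratio of radii of the high-permeability ring.\<close>
  obtain y where y: "Upsilon2D r\<^sub>i r\<^sub>o k1 k2 \<xi> = ln (r\<^sub>o / r\<^sub>i) / kL - (1 / kL - 1 / kH) * y"
    and y_le: "y \<le> ln (\<eta> / r\<^sub>i)"
  proof (cases "(k1, k2) = (kH, kL) \<and> \<xi>\<^sup>2 - r\<^sub>i\<^sup>2 \<le> \<gamma> * (r\<^sub>o\<^sup>2 - r\<^sub>i\<^sup>2)")
    case True
    then have "\<xi> \<le> \<eta>"
      using \<eta> assms(1) by (auto intro: power2_le_imp_le)
    then have "ln (\<xi> / r\<^sub>i) \<le> ln (\<eta> / r\<^sub>i)"
      using \<xi> assms(1) by (simp add: divide_right_mono)
    then show thesis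
      using that inner[of \<xi>] True \<xi> assms(1) by auto
  next
    case False
    then have outside: "(k1, k2) = (kL, kH)" "r\<^sub>o\<^sup>2 - \<xi>\<^sup>2 \<le> \<gamma> * (r\<^sub>o\<^sup>2 - r\<^sub>i\<^sup>2)"
      using assms(7) by (auto simp: admissible_layout_def)
    then have "r\<^sub>o / \<xi> \<le> \<eta> / r\<^sub>i"
      using inner_ring_ratio[of r\<^sub>i \<xi> r\<^sub>o \<eta>] \<xi> \<eta> assms(1) by auto
    then have "ln (r\<^sub>o / \<xi>) \<le> ln (\<eta> / r\<^sub>i)"
      using \<xi> \<eta> assms(1,2) by (intro ln_mono) auto
    then show thesis
      using that outer[of \<xi>] outside \<xi> assms(1) by auto
  qed
  have "(1 / kL - 1 / kH) * y \<le> (1 / kL - 1 / kH) * ln (\<eta> / r\<^sub>i)"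
    using y_le gain by (rule mult_left_mono)
  then show ?thesis
    unfolding \<eta>_def[symmetric] y using inner[of \<eta>] \<eta> assms(1) by simp
qed

theorem mainTheorem4:
  fixes r\<^sub>i r\<^sub>o \<mu> kH kL \<gamma> v\<^sub>o p\<^sub>o :: real
  assumes "0 < r\<^sub>i" and "r\<^sub>i < r\<^sub>o" and "0 < \<mu>"
    and "0 < kL" and "kL \<le> kH"
    and "0 \<le> \<gamma>" and "\<gamma> \<le> 1"
  shows
    "(\<forall>k1 k2 \<xi>. single_interface_layout r\<^sub>i r\<^sub>o kH kL k1 k2 \<xi> \<longrightarrow>
        (\<exists>v p. darcy_solution r\<^sub>i r\<^sub>o \<mu> v\<^sub>o p\<^sub>o (permeability k1 k2 \<xi>) \<xi> v p) \<and>
        (\<forall>v p. darcy_solution r\<^sub>i r\<^sub>o \<mu> v\<^sub>o p\<^sub>o (permeability k1 k2 \<xi>) \<xi> v p \<longrightarrow>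
           (\<forall>r\<in>{r\<^sub>i..r\<^sub>o}. v r = v\<^sub>o * r\<^sub>i / r) \<and>
           dissipation r\<^sub>i r\<^sub>o \<mu> (permeability k1 k2 \<xi>) v =
             2 * pi * \<mu> * v\<^sub>o\<^sup>2 * r\<^sub>i\<^sup>2 * Upsilon2D r\<^sub>i r\<^sub>o k1 k2 \<xi>)) \<and>
     admissible_layout r\<^sub>i r\<^sub>o kH kL \<gamma> kH kL (xi_hat2D r\<^sub>i r\<^sub>o \<gamma>) \<and>
     (\<forall>k1 k2 \<xi> v p v' p'.
        admissible_layout r\<^sub>i r\<^sub>o kH kL \<gamma> k1 k2 \<xi> \<longrightarrow>
        darcy_solution r\<^sub>i r\<^sub>o \<mu> v\<^sub>o p\<^sub>o (permeability k1 k2 \<xi>) \<xi> v p \<longrightarrow>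
        darcy_solution r\<^sub>i r\<^sub>o \<mu> v\<^sub>o p\<^sub>o
          (permeability kH kL (xi_hat2D r\<^sub>i r\<^sub>o \<gamma>)) (xi_hat2D r\<^sub>i r\<^sub>o \<gamma>) v' p' \<longrightarrow>
        dissipation r\<^sub>i r\<^sub>o \<mu> (permeability kH kL (xi_hat2D r\<^sub>i r\<^sub>o \<gamma>)) v' \<le>
        dissipation r\<^sub>i r\<^sub>o \<mu> (permeability k1 k2 \<xi>) v)"
proof (intro conjI allI impI)
  fix k1 k2 \<xi>
  assume "single_interface_layout r\<^sub>i r\<^sub>o kH kL k1 k2 \<xi>"
  then have \<xi>: "r\<^sub>i \<le> \<xi>" "\<xi> \<le> r\<^sub>o"
    by (auto simp: single_interface_layout_def)
  show "\<exists>v p. darcy_solution r\<^sub>i r\<^sub>o \<mu> v\<^sub>o p\<^sub>o (permeability k1 k2 \<xi>) \<xi> v p"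
    using darcy_solution_exists[OF assms(1) \<xi>(1)] by blast
  fix v p
  assume sol: "darcy_solution r\<^sub>i r\<^sub>o \<mu> v\<^sub>o p\<^sub>o (permeability k1 k2 \<xi>) \<xi> v p"
  show "\<forall>r\<in>{r\<^sub>i..r\<^sub>o}. v r = v\<^sub>o * r\<^sub>i / r"
    using darcy_velocity[OF assms(1) sol] by blast
  show "dissipation r\<^sub>i r\<^sub>o \<mu> (permeability k1 k2 \<xi>) v =
      2 * pi * \<mu> * v\<^sub>o\<^sup>2 * r\<^sub>i\<^sup>2 * Upsilon2D r\<^sub>i r\<^sub>o k1 k2 \<xi>"
    using assms(1) \<xi> sol by (rule darcy_dissipation)
next
  show "admissible_layout r\<^sub>i r\<^sub>o kH kL \<gamma> kH kL (xi_hat2D r\<^sub>i r\<^sub>o \<gamma>)"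
    using xi_hat2D_bounds[of r\<^sub>i r\<^sub>o \<gamma>] xi_hat2D_square[of \<gamma> r\<^sub>i r\<^sub>o] assms
    by (simp add: admissible_layout_def)
next
  fix k1 k2 \<xi> v p v' p'
  let ?\<eta> = "xi_hat2D r\<^sub>i r\<^sub>o \<gamma>"
  assume adm: "admissible_layout r\<^sub>i r\<^sub>o kH kL \<gamma> k1 k2 \<xi>"
    and sol: "darcy_solution r\<^sub>i r\<^sub>o \<mu> v\<^sub>o p\<^sub>o (permeability k1 k2 \<xi>) \<xi> v p"
    and sol': "darcy_solution r\<^sub>i r\<^sub>o \<mu> v\<^sub>o p\<^sub>o (permeability kH kL ?\<eta>) ?\<eta> v' p'"
  have "dissipation r\<^sub>i r\<^sub>o \<mu> (permeability kH kL ?\<eta>) v' =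
      2 * pi * \<mu> * v\<^sub>o\<^sup>2 * r\<^sub>i\<^sup>2 * Upsilon2D r\<^sub>i r\<^sub>o kH kL ?\<eta>"
    using darcy_dissipation[OF assms(1) _ _ sol'] xi_hat2D_bounds[of r\<^sub>i r\<^sub>o \<gamma>] assms by simp
  also have "\<dots> \<le> 2 * pi * \<mu> * v\<^sub>o\<^sup>2 * r\<^sub>i\<^sup>2 * Upsilon2D r\<^sub>i r\<^sub>o k1 k2 \<xi>"
    using Upsilon2D_xi_hat2D_le[OF assms(1,2,4-7) adm] assms(3)
    by (intro mult_left_mono) auto
  also have "\<dots> = dissipation r\<^sub>i r\<^sub>o \<mu> (permeability k1 k2 \<xi>) v"
    using darcy_dissipation[OF assms(1) _ _ sol] adm by (simp add: admissible_layout_def)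
  finally show "dissipation r\<^sub>i r\<^sub>o \<mu> (permeability kH kL ?\<eta>) v' \<le>
      dissipation r\<^sub>i r\<^sub>o \<mu> (permeability k1 k2 \<xi>) v" .
qed

end
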